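(* Let $p,q$ and $m$ be integers with $p,q\ge 1$ and $m\ge -2$. Then the integral $$J(m,p,q):=\int_0^1 x^m\,\mathrm{Li}_p(x)\,\mathrm{Li}_q(x)\,dx$$ is reducible to a rational constant and zeta values at positive integers; that is, $J(m,p,q)$ is a linear combination with rational coefficients of $1$ and finite products of values $\zeta(n)$ with integers $n\ge 2$.
   Context: For an integer $p$ and $|x|<1$, $\mathrm{Li}_p(x)=\sum_{k\ge 1} x^k/k^p$ is the polylogarithm. $\zeta$ is the Riemann zeta function. A quantity is called reducible to given constants if it can be expressed as a rational linear combination of them; for zeta values, products of zeta values are allowed (i.e. polynomial expressions with rational coefficients in zeta values). *)

theory Defs
  imports "HOL-Analysis.Analysis" "HOL-Library.Multiset"
begin

text \<open>
  The series is the polylogarithm only for \<open>norm x < 1\<close>; the summation index is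
  shifted by one.
\<close>

definition polylog :: "int \<Rightarrow> 'a :: {real_normed_field, banach} \<Rightarrow> 'a" where
  "polylog p x = (\<Sum>k. x ^ Suc k / of_nat (Suc k) powi p)"

text \<open>
  The Riemann zeta function at integers \<open>n \<ge> 2\<close>, where its Dirichlet series converges.
  The value at \<open>n < 2\<close> is meaningless.
\<close>

definition zeta :: "nat \<Rightarrow> real" where
  "zeta n = (\<Sum>k. 1 / of_nat (Suc k) ^ n)"

text \<open>
  A finite product of zeta values is indexed by the multiset of its arguments; the empty
  multiset contributes the constant 1.
\<close>

definition zeta_reducible :: "real \<Rightarrow> bool" where
  "zeta_reducible y \<longleftrightarrow>
     (\<exists>(S :: nat multiset set) (c :: nat multiset \<Rightarrow> rat).
        finite S \<and> (\<forall>M\<in>S. \<forall>n\<in>#M. n \<ge> 2) \<and>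
        y = (\<Sum>M\<in>S. of_rat (c M) * (\<Prod>n\<in>#M. zeta n)))"

definition J_integrand :: "int \<Rightarrow> int \<Rightarrow> int \<Rightarrow> real \<Rightarrow> real" where
  "J_integrand m p q x = x powi m * polylog p x * polylog q x"

text \<open>
  The open interval avoids the endpoints, where the integrand may be undefined
  (\<open>x = 0\<close> for negative \<open>m\<close>, \<open>x = 1\<close> for \<open>p = 1\<close> or \<open>q = 1\<close>).
\<close>

definition J :: "int \<Rightarrow> int \<Rightarrow> int \<Rightarrow> real" where
  "J m p q = integral {0<..<1} (J_integrand m p q)"

end

theory Submission
  imports Defs
begin

text \<open>
  Expanding both polylogarithms and integrating termwise turns \<open>J m p q\<close> into the double series
  \<open>\<Sum>k,l\<ge>1. 1 / (k^p l^q (k + l + r))\<close> with \<open>r = m + 1 \<ge> -1\<close>. The identity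
  \<open>r = (k + l + r) - k - l\<close> lowers \<open>p\<close> and \<open>q\<close> at the cost of products of zeta values, until one
  exponent is 1; for \<open>r = 0\<close> it exchanges weight between \<open>p\<close> and \<open>q\<close> instead. With \<open>q = 1\<close> the
  inner sum telescopes, and what remains is \<open>\<Sum>k. H_k / k^p\<close> up to elementary series. Euler's
  evaluation of this sum follows by comparing two expansions of multiple zeta values: repeated
  partial fractions in \<open>1 / (k l) = (1 / k + 1 / l) / (k + l)\<close>, and the splitting of
  \<open>zeta a * zeta b\<close> according to \<open>k < l\<close>, \<open>k = l\<close>, \<open>k > l\<close>.
\<close>

section \<open>Reducible numbers form a rational algebra\<close>

lemma zeta_reducible_add:
  assumes "zeta_reducible y" "zeta_reducible z"
  shows "zeta_reducible (y + z)"
proof -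
  obtain S c where S: "finite S" "\<forall>M\<in>S. \<forall>n\<in>#M. n \<ge> 2"
    and y: "y = (\<Sum>M\<in>S. of_rat (c M) * (\<Prod>n\<in>#M. zeta n))"
    using assms(1) unfolding zeta_reducible_def by blast
  obtain T d where T: "finite T" "\<forall>M\<in>T. \<forall>n\<in>#M. n \<ge> 2"
    and z: "z = (\<Sum>M\<in>T. of_rat (d M) * (\<Prod>n\<in>#M. zeta n))"
    using assms(2) unfolding zeta_reducible_def by blast
  \<comment> \<open>Values of \<open>c\<close> outside \<open>S\<close> and of \<open>d\<close>
    outside \<open>T\<close> are arbitrary, so both families are cut off to 0 before they are added
    on the common index set.\<close>
  define e where "e M = (if M \<in> S then c M else 0) + (if M \<in> T then d M else 0)" for M
  have "y = (\<Sum>M\<in>S \<union> T. of_rat (if M \<in> S then c M else 0) * (\<Prod>n\<in>#M. zeta n))"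
    unfolding y by (rule sum.mono_neutral_cong_left) (use S T in auto)
  moreover have "z = (\<Sum>M\<in>S \<union> T. of_rat (if M \<in> T then d M else 0) * (\<Prod>n\<in>#M. zeta n))"
    unfolding z by (rule sum.mono_neutral_cong_left) (use S T in auto)
  ultimately have "y + z = (\<Sum>M\<in>S \<union> T. of_rat (e M) * (\<Prod>n\<in>#M. zeta n))"
    by (simp add: e_def of_rat_add distrib_right sum.distrib)
  then show ?thesis
    unfolding zeta_reducible_def using S T by (intro exI[of _ "S \<union> T"] exI[of _ e]) auto
qed

lemma zeta_reducible_monomial:
  assumes "\<And>n. n \<in># M \<Longrightarrow> n \<ge> 2"
  shows "zeta_reducible (of_rat a * (\<Prod>n\<in>#M. zeta n))"
  unfolding zeta_reducible_def
  by (intro exI[of _ "{M}"] exI[of _ "\<lambda>_. a"]) (use assms in auto)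

lemma zeta_reducible_Rats:
  assumes "y \<in> \<rat>"
  shows "zeta_reducible y"
  using assms zeta_reducible_monomial[of "{#}"] by (auto elim: Rats_cases)

lemma zeta_reducible_zeta: "n \<ge> 2 \<Longrightarrow> zeta_reducible (zeta n)"
  using zeta_reducible_monomial[of "{#n#}" 1] by simp

lemma zeta_reducible_sum:
  assumes "\<And>i. i \<in> I \<Longrightarrow> zeta_reducible (f i)"
  shows "zeta_reducible (\<Sum>i\<in>I. f i)"
  using assms
  by (induction I rule: infinite_finite_induct)
     (auto intro: zeta_reducible_add zeta_reducible_Rats)

lemma zeta_reducible_mult:
  assumes "zeta_reducible y" "zeta_reducible z"
  shows "zeta_reducible (y * z)"
proof -
  obtain S c where S: "\<forall>M\<in>S. \<forall>n\<in>#M. n \<ge> 2"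
    and y: "y = (\<Sum>M\<in>S. of_rat (c M) * (\<Prod>n\<in>#M. zeta n))"
    using assms(1) unfolding zeta_reducible_def by blast
  obtain T d where T: "\<forall>M\<in>T. \<forall>n\<in>#M. n \<ge> 2"
    and z: "z = (\<Sum>M\<in>T. of_rat (d M) * (\<Prod>n\<in>#M. zeta n))"
    using assms(2) unfolding zeta_reducible_def by blast
  \<comment> \<open>Different pairs \<open>(M, N)\<close> can share the same \<open>M + N\<close>,
    so this is not yet a sum over a set of multisets; closure under addition merges the repeated
    monomials.\<close>
  have "y * z = (\<Sum>M\<in>S. \<Sum>N\<in>T. of_rat (c M * d N) * (\<Prod>n\<in>#M + N. zeta n))"
    unfolding y z sum_product by (simp add: of_rat_mult mult_ac)
  also have "zeta_reducible \<dots>"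
    using S T by (intro zeta_reducible_sum zeta_reducible_monomial) auto
  finally show ?thesis .
qed

lemma zeta_reducible_diff:
  assumes "zeta_reducible y" "zeta_reducible z"
  shows "zeta_reducible (y - z)"
proof -
  have "zeta_reducible (y + (-1) * z)"
    using assms by (intro zeta_reducible_add zeta_reducible_mult[OF zeta_reducible_Rats]) auto
  then show ?thesis by simp
qed

text \<open>Serves the relations below that determine a wanted value only up to a nonzero rational
  factor such as \<open>2\<close> or \<open>real s - 1\<close>.\<close>

lemma zeta_reducible_cancel:
  assumes "zeta_reducible (r * y)" "r \<in> \<rat>" "r \<noteq> 0"
  shows "zeta_reducible y"
proof -
  have "zeta_reducible (inverse r * (r * y))"
    using assms by (auto intro!: zeta_reducible_mult[OF zeta_reducible_Rats[of "inverse r"]])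
  then show ?thesis using assms(3) by (simp add: mult.assoc[symmetric])
qed

section \<open>Telescoping series and harmonic numbers\<close>

text \<open>A shift by \<open>r\<close> is made of unit shifts: going from \<open>r\<close> to
  \<open>Suc r\<close> adds the series of \<open>g (k + r) - g (k + Suc r)\<close>, which telescopes
  to \<open>g r\<close>.\<close>

lemma sums_diff_shift:
  fixes g :: "nat \<Rightarrow> 'a :: real_normed_vector"
  assumes "g \<longlonglongrightarrow> 0"
  shows "(\<lambda>k. g k - g (k + r)) sums (\<Sum>i<r. g i)"
proof (induction r)
  case (Suc r)
  have "(\<lambda>k. g (k + r)) \<longlonglongrightarrow> 0"
    using assms by (rule LIMSEQ_ignore_initial_segment)
  from telescope_sums'[OF this]
  have "(\<lambda>k. g (k + r) - g (k + Suc r)) sums g r" by simp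
  from sums_add[OF Suc this] show ?case by simp
qed simp

lemma sums_inverse_diff_shift:
  "(\<lambda>k. 1 / real (Suc k) - 1 / real (Suc (k + r))) sums harm r"
proof -
  have "(\<lambda>k. inverse (real (Suc k))) \<longlonglongrightarrow> 0" by (rule LIMSEQ_inverse_real_of_nat)
  from sums_diff_shift[OF this, of r] show ?thesis
    by (simp add: harm_altdef inverse_eq_divide)
qed

lemma harm_over_tendsto_0: "(\<lambda>n. harm (Suc n) / real (Suc n)) \<longlonglongrightarrow> 0"
proof -
  \<comment> \<open>\<open>harm n\<close> is \<open>ln n\<close> plus a sequence converging to the
    Euler-Mascheroni constant; both parts vanish after division by \<open>n\<close>.\<close>
  have "(\<lambda>n. (harm n - ln (real n)) * (1 / real n) + ln (real n) / real n :: real) \<longlonglongrightarrow> euler_mascheroni * 0 + 0"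
    by (intro tendsto_add tendsto_mult euler_mascheroni_LIMSEQ lim_1_over_n
        filterlim_compose[OF ln_x_over_x_tendsto_0] filterlim_real_sequentially)
  also have "(\<lambda>n. (harm n - ln (real n)) * (1 / real n) + ln (real n) / real n :: real)
       = (\<lambda>n. harm n / real n)"
    by (auto simp: diff_divide_distrib)
  finally show ?thesis using LIMSEQ_Suc by fastforce
qed

lemma harm_Rats: "harm n \<in> (\<rat> :: real set)"
  unfolding harm_def by (intro Rats_sum) auto

lemma harm_add: "harm (n + r) = (harm n + (\<Sum>i<r. 1 / real (Suc (n + i))) :: real)"
  by (induction r) (simp_all add: harm_Suc inverse_eq_divide)

section \<open>Zeta values as convergent series\<close>

lemma zeta_sums:
  assumes "n \<ge> 2"
  shows "(\<lambda>k. 1 / real (Suc k) ^ n) sums zeta n"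
proof -
  have "summable (\<lambda>k. inverse (real k ^ n))"
    using assms by (intro inverse_power_summable) auto
  then have "summable (\<lambda>k. 1 / real (Suc k) ^ n)"
    by (subst (asm) summable_Suc_iff[symmetric]) (simp add: inverse_eq_divide)
  then show ?thesis unfolding zeta_def by (simp add: summable_sums)
qed

lemma zeta_has_sum:
  assumes "n \<ge> 2"
  shows "((\<lambda>k. 1 / real (Suc k) ^ n) has_sum zeta n) UNIV"
  using zeta_sums[OF assms] by (intro sums_nonneg_imp_has_sum) auto

section \<open>Tornheim series\<close>

text \<open>
  Indices start at 0, so the last factor is \<open>k + l + r\<close> with \<open>r = s - 1\<close> in terms of indices
  starting at 1; Tornheim's own series is the case \<open>s = 1\<close>, and \<open>tornheim 1 a 0 c\<close> is the double
  zeta value \<open>\<Sum>n>k\<ge>1. 1 / (k^a n^c)\<close>.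
\<close>
definition tornheim_term :: "nat \<Rightarrow> nat \<Rightarrow> nat \<Rightarrow> nat \<Rightarrow> nat \<times> nat \<Rightarrow> real" where
  "tornheim_term s a b c =
     (\<lambda>(k, l). 1 / (real (Suc k) ^ a * real (Suc l) ^ b * real (Suc (k + l + s)) ^ c))"

definition tornheim :: "nat \<Rightarrow> nat \<Rightarrow> nat \<Rightarrow> nat \<Rightarrow> real" where
  "tornheim s a b c = infsum (tornheim_term s a b c) UNIV"

section \<open>Convergence of the double series\<close>

lemma tornheim_term_nonneg: "tornheim_term s a b c x \<ge> 0"
  by (auto simp: tornheim_term_def split: prod.split)

lemma has_sum_prod:
  fixes f g :: "nat \<Rightarrow> real"
  assumes "(f has_sum S) UNIV" "(g has_sum T) UNIV" "\<And>k. f k \<ge> 0" "\<And>k. g k \<ge> 0"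
  shows "((\<lambda>(k, l). f k * g l) has_sum (S * T)) UNIV"
proof -
  have inner: "((\<lambda>l. case (k, l) of (k, l) \<Rightarrow> f k * g l) has_sum (f k * T)) UNIV" for k
    using assms by (simp add: has_sum_cmult_right)
  have outer: "((\<lambda>k. f k * T) has_sum (S * T)) UNIV"
    using assms by (intro has_sum_cmult_left)
  have "(\<lambda>(k, l). f k * g l) summable_on (UNIV \<times> UNIV)"
    by (rule summable_on_SigmaI[OF inner]) (use outer assms in \<open>auto simp: summable_on_def\<close>)
  from has_sum_SigmaI[OF inner outer this] show ?thesis by simp
qed

text \<open>With \<open>x = k + 1\<close> and \<open>y = l + 1\<close> the last factor is \<open>x + y - 1 \<ge> max x y \<ge> sqrt (x y)\<close>.\<close>
lemma tornheim_summable_0: "tornheim_term 0 1 1 1 summable_on UNIV"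
proof -
  define g where "g k = real (Suc k) powr (-3/2)" for k
  have "summable (\<lambda>k. real k powr (-3/2))" by (subst summable_real_powr_iff) auto
  then have "summable g"
    unfolding g_def by (subst (asm) summable_Suc_iff[symmetric])
  then have "(g has_sum suminf g) UNIV"
    by (intro sums_nonneg_imp_has_sum) (auto simp: g_def summable_sums)
  from has_sum_prod[OF this this]
  have "(\<lambda>(k, l). g k * g l) summable_on UNIV" by (auto simp: summable_on_def g_def)
  then show ?thesis
  proof (rule summable_on_comparison_test)
    fix z :: "nat \<times> nat"
    obtain k l where z: "z = (k, l)" by fastforce
    define x where "x = real (Suc k)"
    define y where "y = real (Suc l)"
    have xy: "x \<ge> 1" "y \<ge> 1" by (auto simp: x_def y_def)
    have pw: "t powr (3/2) = t * sqrt t" if "t \<ge> 1" for t :: real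
    proof -
      have "t powr (1 + 1/2) = t powr 1 * t powr (1/2)" by (rule powr_add)
      then show ?thesis using that by (simp add: powr_half_sqrt)
    qed
    have "x * y \<le> (x + y - 1)\<^sup>2"
    proof -
      \<comment> \<open>With \<open>u = x - 1\<close> and \<open>v = y - 1\<close>, the difference
        of the two sides is \<open>u^2 + v^2 + u * v + u + v\<close>.\<close>
      have "(x - 1) * (y - 1) \<ge> 0" "(x-1)^2 \<ge> 0" "(y-1)^2 \<ge> 0" using xy by auto
      then show ?thesis using xy by (simp add: power2_eq_square algebra_simps)
    qed
    then have "sqrt (x * y) \<le> x + y - 1"
      using xy by (intro real_le_lsqrt) auto
    then have "(x * y) * sqrt (x * y) \<le> (x * y) * (x + y - 1)"
      using xy by (intro mult_left_mono) auto
    moreover have "x powr (3/2) * y powr (3/2) = (x * y) * sqrt (x * y)"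
      using xy by (simp add: pw real_sqrt_mult)
    ultimately have "1 / (x * y * (x + y - 1)) \<le> 1 / (x powr (3/2) * y powr (3/2))"
      using xy by (intro divide_left_mono mult_pos_pos) auto
    also have "\<dots> = g k * g l"
      by (simp add: g_def x_def y_def powr_minus_divide)
    finally show "tornheim_term 0 1 1 1 z \<le> (\<lambda>(k, l). g k * g l) z"
      by (simp add: z tornheim_term_def x_def y_def add_ac)
  qed (rule tornheim_term_nonneg)
qed

lemma tornheim_term_le:
  assumes "Suc k ^ a' * Suc l ^ b' * Suc (k + l + s') ^ c' \<le> Suc k ^ a * Suc l ^ b * Suc (k + l + s) ^ c"
  shows "tornheim_term s a b c (k, l) \<le> tornheim_term s' a' b' c' (k, l)"
proof -
  have "real (Suc k ^ a' * Suc l ^ b' * Suc (k + l + s') ^ c') \<le> real (Suc k ^ a * Suc l ^ b * Suc (k + l + s) ^ c)"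
    using assms by (simp only: of_nat_le_iff)
  then show ?thesis unfolding tornheim_term_def prod.case
    by (intro divide_left_mono mult_pos_pos) (auto simp del: of_nat_Suc)
qed

lemma tornheim_summable_111: "tornheim_term s 1 1 1 summable_on UNIV"
  using tornheim_summable_0
  by (rule summable_on_comparison_test)
     (auto intro!: tornheim_term_le tornheim_term_nonneg simp del: mult_Suc mult_Suc_right power_Suc)

text \<open>Everything is compared with exponents 1, 1, 1. If the first or second exponent may be 0,
  then \<open>c \<ge> 2\<close>, and one copy of \<open>k + l + s + 1\<close> replaces the missing
  smaller factor \<open>l + 1\<close> or \<open>k + 1\<close>.\<close>

lemma tornheim_summable:
  assumes "a \<ge> 1 \<and> b \<ge> 1 \<and> c \<ge> 1 \<or> c \<ge> 2 \<and> (a \<ge> 1 \<or> b \<ge> 1)"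
  shows "tornheim_term s a b c summable_on UNIV"
  using tornheim_summable_111[of s]
proof (rule summable_on_comparison_test)
  fix z :: "nat \<times> nat"
  obtain k l where z: "z = (k, l)" by fastforce
  have pow: "Suc n ^ i \<le> Suc n ^ j" if "i \<le> j" for n i j :: nat
    using that by (intro power_increasing) auto
  consider "a \<ge> 1" "b \<ge> 1" "c \<ge> 1" | "c \<ge> 2" "a \<ge> 1" | "c \<ge> 2" "b \<ge> 1" using assms by blast
  then have "Suc k ^ 1 * Suc l ^ 1 * Suc (k + l + s) ^ 1 \<le> Suc k ^ a * Suc l ^ b * Suc (k + l + s) ^ c"
  proof cases
    case 1
    then show ?thesis by (intro mult_le_mono pow) auto
  next
    case 2
    have "Suc k ^ 1 * Suc l ^ 1 * Suc (k + l + s) ^ 1 \<le> Suc k ^ 1 * (Suc (k + l + s) * 1) * Suc (k + l + s) ^ 1"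
      by (intro mult_le_mono) auto
    also have "\<dots> = Suc k ^ 1 * 1 * Suc (k + l + s) ^ 2" by (simp add: power2_eq_square del: mult_Suc mult_Suc_right)
    also have "\<dots> \<le> Suc k ^ a * Suc l ^ b * Suc (k + l + s) ^ c"
      using 2 by (intro mult_le_mono pow) auto
    finally show ?thesis .
  next
    case 3
    have "Suc k ^ 1 * Suc l ^ 1 * Suc (k + l + s) ^ 1 \<le> (Suc (k + l + s) * 1) * Suc l ^ 1 * Suc (k + l + s) ^ 1"
      by (intro mult_le_mono) auto
    also have "\<dots> = 1 * Suc l ^ 1 * Suc (k + l + s) ^ 2" by (simp add: power2_eq_square del: mult_Suc mult_Suc_right)
    also have "\<dots> \<le> Suc k ^ a * Suc l ^ b * Suc (k + l + s) ^ c"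
      using 3 by (intro mult_le_mono pow) auto
    finally show ?thesis .
  qed
  then show "tornheim_term s a b c z \<le> tornheim_term s 1 1 1 z"
    unfolding z by (rule tornheim_term_le)
qed (rule tornheim_term_nonneg)

lemma tornheim_has_sum:
  assumes "a \<ge> 1 \<and> b \<ge> 1 \<and> c \<ge> 1 \<or> c \<ge> 2 \<and> (a \<ge> 1 \<or> b \<ge> 1)"
  shows "(tornheim_term s a b c has_sum tornheim s a b c) UNIV"
  unfolding tornheim_def by (rule has_sum_infsum[OF tornheim_summable[OF assms]])

lemma tornheim_commute: "tornheim s a b c = tornheim s b a c"
  unfolding tornheim_def
  by (rule infsum_reindex_bij_witness[of _ prod.swap prod.swap])
     (auto simp: tornheim_term_def mult_ac add_ac)

text \<open>Put \<open>x = k + 1\<close>, \<open>y = l + 1\<close>,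
  \<open>z = k + l + s + 1\<close>. Dividing \<open>z = (s - 1) + x + y\<close> by
  \<open>x^(p+1) y^(q+1) z\<close> and summing over \<open>k\<close> and \<open>l\<close> makes the
  left side a product of two zeta series.\<close>

lemma tornheim_step:
  assumes "p \<ge> 1" "q \<ge> 1"
  shows "(real s - 1) * tornheim s (Suc p) (Suc q) 1 + tornheim s p (Suc q) 1 + tornheim s (Suc p) q 1
    = zeta (Suc p) * zeta (Suc q)"
proof -
  let ?f = "\<lambda>(k, l). 1 / real (Suc k) ^ Suc p * (1 / real (Suc l) ^ Suc q)"
  have "(?f has_sum (zeta (Suc p) * zeta (Suc q))) UNIV"
    using assms by (intro has_sum_prod zeta_has_sum) auto
  also have "?f = (\<lambda>x. (real s - 1) * tornheim_term s (Suc p) (Suc q) 1 x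
      + tornheim_term s p (Suc q) 1 x + tornheim_term s (Suc p) q 1 x)"
  proof (rule ext)
    fix u :: "nat \<times> nat"
    obtain k l where u: "u = (k, l)" by fastforce
    define x y z where xyz: "x = real (Suc k)" "y = real (Suc l)" "z = real (Suc (k + l + s))"
    have "x > 0" "y > 0" "z > 0" by (auto simp: xyz)
    moreover have "real s - 1 = z - x - y" by (simp add: xyz)
    ultimately have "1 / x ^ Suc p * (1 / y ^ Suc q) = (real s - 1) * (1 / (x ^ Suc p * y ^ Suc q * z ^ 1))
       + 1 / (x ^ p * y ^ Suc q * z ^ 1) + 1 / (x ^ Suc p * y ^ q * z ^ 1)"
      by (simp add: field_simps)
    then show "?f u = (real s - 1) * tornheim_term s (Suc p) (Suc q) 1 u
      + tornheim_term s p (Suc q) 1 u + tornheim_term s (Suc p) q 1 u"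
      unfolding u tornheim_term_def prod.case xyz .
  qed
  finally show ?thesis
    by (rule has_sum_unique[rotated])
       (use assms in \<open>auto intro!: has_sum_add has_sum_cmult_right tornheim_has_sum\<close>)
qed

text \<open>In the same notation \<open>1/y - 1/z = (x + s - 1) / (y z)\<close>. For fixed
  \<open>k\<close> the left side telescopes over \<open>l\<close> to \<open>harm (k + s)\<close>; on
  the right the summand \<open>x\<close> cancels one power of \<open>x\<close>.\<close>

lemma harm_sums_tornheim:
  assumes "p \<ge> 1"
  shows "(\<lambda>k. harm (k + s) / real (Suc k) ^ Suc p) sums
    ((real s - 1) * tornheim s (Suc p) 1 1 + tornheim s p 1 1)"
proof -
  let ?f = "\<lambda>x. (real s - 1) * tornheim_term s (Suc p) 1 1 x + tornheim_term s p 1 1 x"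
  have "(?f has_sum ((real s - 1) * tornheim s (Suc p) 1 1 + tornheim s p 1 1)) (UNIV \<times> UNIV)"
    using assms by (auto intro!: has_sum_add has_sum_cmult_right tornheim_has_sum)
  moreover have "((\<lambda>l. ?f (k, l)) has_sum (harm (k + s) / real (Suc k) ^ Suc p)) UNIV" for k
  proof -
    have "((\<lambda>l. 1 / real (Suc l) - 1 / real (Suc (l + (k + s)))) has_sum harm (k + s)) UNIV"
      using sums_inverse_diff_shift[of "k + s"]
      by (intro sums_nonneg_imp_has_sum) (auto intro!: divide_left_mono)
    then have "((\<lambda>l. (1 / real (Suc l) - 1 / real (Suc (l + (k + s)))) * (1 / real (Suc k) ^ Suc p))
        has_sum (harm (k + s) * (1 / real (Suc k) ^ Suc p))) UNIV"
      by (rule has_sum_cmult_left)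
    also have "(\<lambda>l. (1 / real (Suc l) - 1 / real (Suc (l + (k + s)))) * (1 / real (Suc k) ^ Suc p))
      = (\<lambda>l. ?f (k, l))"
    proof
      fix l
      define x y z where xyz: "x = real (Suc k)" "y = real (Suc l)" "z = real (Suc (k + l + s))"
      have "x > 0" "y > 0" "z > 0" by (auto simp: xyz)
      moreover have "real s - 1 = z - x - y" by (simp add: xyz)
      ultimately have "(1 / y - 1 / z) * (1 / x ^ Suc p) =
          (real s - 1) * (1 / (x ^ Suc p * y ^ 1 * z ^ 1)) + 1 / (x ^ p * y ^ 1 * z ^ 1)"
        by (simp add: field_simps)
      then show "(1 / real (Suc l) - 1 / real (Suc (l + (k + s)))) * (1 / real (Suc k) ^ Suc p) = ?f (k, l)"
        unfolding tornheim_term_def prod.case xyz by (simp add: add_ac)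
    qed
    finally show ?thesis by simp
  qed
  ultimately have "((\<lambda>k. harm (k + s) / real (Suc k) ^ Suc p) has_sum
     ((real s - 1) * tornheim s (Suc p) 1 1 + tornheim s p 1 1)) UNIV"
    by (rule has_sum_SigmaD)
  then show ?thesis by (rule has_sum_imp_sums)
qed

section \<open>Euler's evaluation of the linear harmonic sums\<close>

text \<open>For \<open>s = 1\<close> the last factor is exactly \<open>z = x + y\<close>, so
  multiplying a term by \<open>(x + y) / z\<close> splits it in two and moves one unit of exponent
  to \<open>z\<close>.\<close>

lemma tornheim_partial_fraction:
  assumes "c \<ge> 1"
  shows "tornheim 1 (Suc a) (Suc b) c = tornheim 1 a (Suc b) (Suc c) + tornheim 1 (Suc a) b (Suc c)"
proof -
  have "tornheim_term 1 (Suc a) (Suc b) c =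
      (\<lambda>u. tornheim_term 1 a (Suc b) (Suc c) u + tornheim_term 1 (Suc a) b (Suc c) u)"
  proof
    fix u :: "nat \<times> nat"
    obtain k l where u: "u = (k, l)" by fastforce
    define x y z where xyz: "x = real (Suc k)" "y = real (Suc l)" "z = real (Suc (k + l + 1))"
    have "x > 0" "y > 0" "z > 0" by (auto simp: xyz)
    then have "1 / (x ^ Suc a * y ^ Suc b * z ^ c) = z / (x ^ Suc a * y ^ Suc b * z ^ Suc c)"
      "1 / (x ^ a * y ^ Suc b * z ^ Suc c) + 1 / (x ^ Suc a * y ^ b * z ^ Suc c) =
        (x + y) / (x ^ Suc a * y ^ Suc b * z ^ Suc c)"
      by (simp_all add: field_simps)
    moreover have "z = x + y" by (simp add: xyz)
    ultimately have "1 / (x ^ Suc a * y ^ Suc b * z ^ c) =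
        1 / (x ^ a * y ^ Suc b * z ^ Suc c) + 1 / (x ^ Suc a * y ^ b * z ^ Suc c)"
      by simp
    then show "tornheim_term 1 (Suc a) (Suc b) c u =
        tornheim_term 1 a (Suc b) (Suc c) u + tornheim_term 1 (Suc a) b (Suc c) u"
      unfolding u tornheim_term_def prod.case xyz .
  qed
  moreover have "((\<lambda>u. tornheim_term 1 a (Suc b) (Suc c) u + tornheim_term 1 (Suc a) b (Suc c) u)
      has_sum (tornheim 1 a (Suc b) (Suc c) + tornheim 1 (Suc a) b (Suc c))) UNIV"
    using assms by (intro has_sum_add tornheim_has_sum) auto
  ultimately show ?thesis
    unfolding tornheim_def[of 1 "Suc a" "Suc b" c] by (simp add: infsumI)
qed

lemma zeta_stuffle:
  assumes "a \<ge> 2" "b \<ge> 2"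
  shows "zeta a * zeta b = tornheim 1 a 0 b + tornheim 1 b 0 a + zeta (a + b)"
proof -
  let ?f = "\<lambda>(k, l). 1 / real (Suc k) ^ a * (1 / real (Suc l) ^ b)"
  have "(?f has_sum tornheim 1 a 0 b) {(k, l). k < l}"
  proof -
    \<comment> \<open>Writing \<open>l = k + d + 1\<close> gives
      \<open>Suc l = Suc (k + d + 1)\<close>, the last factor for \<open>s = 1\<close>; the gap
      \<open>d\<close> carries exponent 0.\<close>
    have "bij_betw (\<lambda>(k, d). (k, k + d + 1)) UNIV {(k, l :: nat). k < l}"
      by (rule bij_betwI[of _ _ _ "\<lambda>(k, l). (k, l - k - 1)"]) auto
    from has_sum_reindex_bij_betw[OF this, of ?f "tornheim 1 a 0 b"] tornheim_has_sum[of a 0 b 1] assms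
    show ?thesis by (simp add: tornheim_term_def case_prod_unfold)
  qed
  moreover have "(?f has_sum tornheim 1 b 0 a) {(k, l). l < k}"
  proof -
    have "bij_betw (\<lambda>(l, d). (l + d + 1, l)) UNIV {(k, l :: nat). l < k}"
      by (rule bij_betwI[of _ _ _ "\<lambda>(k, l). (l, k - l - 1)"]) auto
    from has_sum_reindex_bij_betw[OF this, of ?f "tornheim 1 b 0 a"] tornheim_has_sum[of b 0 a 1] assms
    show ?thesis by (simp add: tornheim_term_def case_prod_unfold mult_ac)
  qed
  moreover have "(?f has_sum zeta (a + b)) {(k, l). k = l}"
  proof -
    have "bij_betw (\<lambda>k. (k, k)) UNIV {(k, l :: nat). k = l}"
      by (rule bij_betwI[of _ _ _ fst]) auto
    from has_sum_reindex_bij_betw[OF this, of ?f "zeta (a + b)"] zeta_has_sum[of "a + b"] assms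
    show ?thesis by (simp add: power_add)
  qed
  ultimately have "(?f has_sum (tornheim 1 a 0 b + tornheim 1 b 0 a + zeta (a + b)))
      ({(k, l). k < l} \<union> {(k, l). l < k} \<union> {(k, l). k = l})"
    by (intro has_sum_Un_disjoint) auto
  also have "{(k, l). k < l} \<union> {(k, l). l < k} \<union> {(k, l :: nat). k = l} = UNIV" by auto
  finally have "(?f has_sum (tornheim 1 a 0 b + tornheim 1 b 0 a + zeta (a + b))) UNIV" .
  moreover have "(?f has_sum (zeta a * zeta b)) UNIV"
    using assms by (intro has_sum_prod zeta_has_sum) auto
  ultimately show ?thesis by (rule has_sum_unique[rotated])
qed

text \<open>The double zeta value is grouped by the larger index \<open>l\<close>. The smaller one
  runs over \<open>k < l\<close>, so each inner sum is finite and gives \<open>harm l\<close>, not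
  \<open>harm (Suc l)\<close>.\<close>

lemma harm_sums_tornheim_0:
  assumes "w \<ge> 2"
  shows "(\<lambda>k. harm k / real (Suc k) ^ w) sums tornheim 1 1 0 w"
proof -
  let ?f = "\<lambda>(l, k). 1 / (real (Suc k) * real (Suc l) ^ w)"
  have "bij_betw (\<lambda>(k, d). (k + d + 1, k)) UNIV (SIGMA l : UNIV. {..<l :: nat})"
    by (rule bij_betwI[of _ _ _ "\<lambda>(l, k). (k, l - k - 1)"]) auto
  from has_sum_reindex_bij_betw[OF this, of ?f "tornheim 1 1 0 w"] tornheim_has_sum[of 1 0 w 1] assms
  have "(?f has_sum tornheim 1 1 0 w) (SIGMA l : UNIV. {..<l})"
    by (simp add: tornheim_term_def case_prod_unfold)
  moreover have "((\<lambda>k. ?f (l, k)) has_sum (harm l / real (Suc l) ^ w)) {..<l}" for l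
  proof -
    have "((\<lambda>k. ?f (l, k)) has_sum (\<Sum>k<l. ?f (l, k))) {..<l}"
      by (rule has_sum_finite) auto
    also have "(\<Sum>k<l. ?f (l, k)) = harm l / real (Suc l) ^ w"
      by (simp add: harm_altdef sum_divide_distrib inverse_eq_divide)
    finally show ?thesis .
  qed
  ultimately have "((\<lambda>l. harm l / real (Suc l) ^ w) has_sum tornheim 1 1 0 w) UNIV"
    by (rule has_sum_SigmaD)
  then show ?thesis by (rule has_sum_imp_sums)
qed

text \<open>Both sides are the series of \<open>harm (k + 1) / (k + 1)^(p+1)\<close>: one by
  telescoping rows at \<open>s = 1\<close>, the other by splitting off the last summand of
  \<open>harm (k + 1)\<close>.\<close>

lemma tornheim_1_eq:
  assumes "p \<ge> 1"
  shows "tornheim 1 p 1 1 = tornheim 1 1 0 (Suc p) + zeta (p + 2)"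
proof -
  have "(\<lambda>k. harm k / real (Suc k) ^ Suc p + 1 / real (Suc k) ^ (p + 2)) sums
      (tornheim 1 1 0 (Suc p) + zeta (p + 2))"
    using assms by (intro sums_add harm_sums_tornheim_0 zeta_sums) auto
  also have "(\<lambda>k. harm k / real (Suc k) ^ Suc p + 1 / real (Suc k) ^ (p + 2))
      = (\<lambda>k. harm (k + 1) / real (Suc k) ^ Suc p)"
    by (rule ext) (simp add: harm_Suc field_simps del: of_nat_Suc)
  finally show ?thesis
    using harm_sums_tornheim[OF assms, of 1] by (auto dest: sums_unique2)
qed

text \<open>Each partial fraction step lowers the first exponent, raises the last, and splits off a
  double zeta value of the same weight. At exponents 1, 1 the two parts agree by symmetry, hence the
  factor 2.\<close>

lemma tornheim_chain:
  "tornheim 1 (Suc n) 1 (Suc c) =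
     (\<Sum>a<n. tornheim 1 (a + 2) 0 (n + c + 1 - a)) + 2 * tornheim 1 1 0 (n + c + 2)"
proof (induction n arbitrary: c)
  case 0
  show ?case
    using tornheim_partial_fraction[of "Suc c" 0 0] tornheim_commute[of 1 0 1] by simp
next
  case (Suc n)
  show ?case
    using tornheim_partial_fraction[of "Suc c" "Suc n" 0] Suc[of "Suc c"] by simp
qed

text \<open>The chain and \<open>tornheim_1_eq\<close> are two linear relations between the wanted
  value and \<open>tornheim 1 1 0 (n + 2)\<close>. Eliminating the latter leaves the sum
  \<open>S\<close> of double zeta values, which is evaluated only as a whole.\<close>

lemma zeta_reducible_tornheim_1:
  assumes "p \<ge> 1"
  shows "zeta_reducible (tornheim 1 p 1 1)"
proof -
  obtain n where p: "p = Suc n" using assms by (cases p) auto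
  define S where "S = (\<Sum>a<n. tornheim 1 (a + 2) 0 (n + 1 - a))"
  define Z where "Z = (\<Sum>a<n. zeta (a + 2) * zeta (n + 1 - a)) - real n * zeta (n + 3)"
  \<comment> \<open>Reversing the order of summation pairs every double zeta value with its mirror
    image, and the stuffle relation evaluates each pair.\<close>
  have "S = (\<Sum>a<n. tornheim 1 (n + 1 - a) 0 (a + 2))"
    unfolding S_def by (subst sum.nat_diff_reindex[symmetric]) (auto intro!: sum.cong simp: Suc_diff_Suc Suc_diff_le)
  then have "2 * S = (\<Sum>a<n. tornheim 1 (a + 2) 0 (n + 1 - a) + tornheim 1 (n + 1 - a) 0 (a + 2))"
    by (simp add: S_def sum.distrib)
  also have "\<dots> = (\<Sum>a<n. zeta (a + 2) * zeta (n + 1 - a) - zeta (n + 3))"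
  proof (rule sum.cong)
    fix a assume "a \<in> {..<n}"
    then show "tornheim 1 (a + 2) 0 (n + 1 - a) + tornheim 1 (n + 1 - a) 0 (a + 2)
       = zeta (a + 2) * zeta (n + 1 - a) - zeta (n + 3)"
      using zeta_stuffle[of "a + 2" "n + 1 - a"] by (simp add: numeral_3_eq_3)
  qed simp
  also have "\<dots> = Z" by (simp add: Z_def sum_subtractf)
  finally have "2 * S = Z" .
  moreover have "tornheim 1 p 1 1 = S + 2 * tornheim 1 1 0 (n + 2)"
    using tornheim_chain[of n 0] by (simp add: p S_def)
  moreover have "tornheim 1 p 1 1 = tornheim 1 1 0 (n + 2) + zeta (n + 3)"
    using tornheim_1_eq[OF assms] by (simp add: p numeral_3_eq_3)
  ultimately have "2 * tornheim 1 p 1 1 = 4 * zeta (n + 3) - Z" by simp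
  moreover have "zeta_reducible (4 * zeta (n + 3) - Z)"
  proof -
    have "zeta_reducible (\<Sum>a<n. zeta (a + 2) * zeta (n + 1 - a))"
      by (rule zeta_reducible_sum) (auto intro!: zeta_reducible_mult zeta_reducible_zeta)
    moreover have "zeta_reducible (real i * zeta (n + 3))" for i
      by (rule zeta_reducible_mult[OF zeta_reducible_Rats zeta_reducible_zeta]) auto
    from this[of 4] this[of n] have "zeta_reducible (4 * zeta (n + 3))" "zeta_reducible (real n * zeta (n + 3))"
      by simp_all
    ultimately show ?thesis
      unfolding Z_def by (intro zeta_reducible_diff)
  qed
  ultimately have "zeta_reducible (2 * tornheim 1 p 1 1)" by simp
  then show ?thesis by (rule zeta_reducible_cancel) auto
qed

section \<open>Reduction of the general series\<close>

text \<open>The two linear factors differ by the constant \<open>Suc i\<close>, so partial fractions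
  lower \<open>p\<close> at the cost of a zeta value, down to a telescoping series with rational
  sum.\<close>

lemma shifted_sums_reducible:
  assumes "p \<ge> 1"
  shows "\<exists>v. (\<lambda>k. 1 / (real (Suc k) ^ p * real (Suc (k + Suc i)))) sums v \<and> zeta_reducible v"
  using assms
proof (induction p rule: dec_induct)
  case base
  have "(\<lambda>k. inverse (real (Suc i)) * (1 / real (Suc k) - 1 / real (Suc (k + Suc i))))
      sums (inverse (real (Suc i)) * harm (Suc i))"
    by (intro sums_mult sums_inverse_diff_shift)
  also have "(\<lambda>k. inverse (real (Suc i)) * (1 / real (Suc k) - 1 / real (Suc (k + Suc i))))
      = (\<lambda>k. 1 / (real (Suc k) ^ 1 * real (Suc (k + Suc i))))"
    by (rule ext) (simp add: field_simps)
  finally show ?case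
    using zeta_reducible_Rats[of "inverse (real (Suc i)) * harm (Suc i)"] harm_Rats[of "Suc i"] by auto
next
  case (step p)
  then obtain v where v: "(\<lambda>k. 1 / (real (Suc k) ^ p * real (Suc (k + Suc i)))) sums v"
    "zeta_reducible v" by blast
  have "(\<lambda>k. inverse (real (Suc i)) * (1 / real (Suc k) ^ Suc p - 1 / (real (Suc k) ^ p * real (Suc (k + Suc i)))))
      sums (inverse (real (Suc i)) * (zeta (Suc p) - v))"
    using step.hyps by (intro sums_mult sums_diff v zeta_sums) auto
  also have "(\<lambda>k. inverse (real (Suc i)) * (1 / real (Suc k) ^ Suc p - 1 / (real (Suc k) ^ p * real (Suc (k + Suc i)))))
      = (\<lambda>k. 1 / (real (Suc k) ^ Suc p * real (Suc (k + Suc i))))"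
  proof
    fix k
    define x y z where xyz: "x = real (Suc k)" "y = real (Suc i)" "z = real (Suc (k + Suc i))"
    have "x > 0" "y > 0" "z > 0" by (auto simp: xyz)
    then have "inverse y * (1 / x ^ Suc p - 1 / (x ^ p * z)) = (z - x) / y * (1 / (x ^ Suc p * z))"
      by (simp add: field_simps)
    also have "(z - x) / y = 1" using xyz by simp
    finally have "inverse y * (1 / x ^ Suc p - 1 / (x ^ p * z)) = 1 / (x ^ Suc p * z)" by simp
    then show "inverse (real (Suc i)) * (1 / real (Suc k) ^ Suc p - 1 / (real (Suc k) ^ p * real (Suc (k + Suc i))))
      = 1 / (real (Suc k) ^ Suc p * real (Suc (k + Suc i)))"
      unfolding xyz .
  qed
  moreover have "zeta_reducible (inverse (real (Suc i)) * (zeta (Suc p) - v))"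
    using step.hyps v(2)
    by (intro zeta_reducible_mult[OF zeta_reducible_Rats] zeta_reducible_diff zeta_reducible_zeta) auto
  ultimately show ?case by metis
qed

text \<open>The anchor is \<open>s = 1\<close>, where the factor \<open>real s - 1\<close> in
  \<open>harm_sums_tornheim\<close> vanishes and Euler's evaluation applies. Other shifts are
  reached by adding or removing single reciprocals.\<close>

lemma harm_sums_reducible:
  assumes "p \<ge> 2"
  shows "\<exists>v. (\<lambda>k. harm (k + s) / real (Suc k) ^ p) sums v \<and> zeta_reducible v"
proof -
  obtain p' where p: "p = Suc p'" "p' \<ge> 1" using assms by (cases p) auto
  have one: "(\<lambda>k. harm (k + 1) / real (Suc k) ^ p) sums tornheim 1 p' 1 1"
    using harm_sums_tornheim[of p' 1] p by simp
  have red: "zeta_reducible (tornheim 1 p' 1 1)"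
    using p by (intro zeta_reducible_tornheim_1)
  show ?thesis
  proof (cases s)
    case 0
    have "(\<lambda>k. harm (k + 1) / real (Suc k) ^ p - 1 / real (Suc k) ^ Suc p)
        sums (tornheim 1 p' 1 1 - zeta (Suc p))"
      using p by (intro sums_diff one zeta_sums) auto
    also have "(\<lambda>k. harm (k + 1) / real (Suc k) ^ p - 1 / real (Suc k) ^ Suc p)
        = (\<lambda>k. harm (k + s) / real (Suc k) ^ p)"
      by (rule ext) (simp add: 0 harm_Suc field_simps del: of_nat_Suc)
    moreover have "zeta_reducible (tornheim 1 p' 1 1 - zeta (Suc p))"
      using red p by (intro zeta_reducible_diff zeta_reducible_zeta) auto
    ultimately show ?thesis by metis
  next
    case (Suc r)
    have "\<exists>v. (\<lambda>k. harm (k + Suc r) / real (Suc k) ^ p) sums v \<and> zeta_reducible v"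
    proof (induction r)
      case 0
      then show ?case using one red by auto
    next
      case (Suc r)
      then obtain v where v: "(\<lambda>k. harm (k + Suc r) / real (Suc k) ^ p) sums v" "zeta_reducible v"
        by blast
      obtain u where u: "(\<lambda>k. 1 / (real (Suc k) ^ p * real (Suc (k + Suc r)))) sums u" "zeta_reducible u"
        using shifted_sums_reducible[of p r] assms by auto
      have "(\<lambda>k. harm (k + Suc r) / real (Suc k) ^ p + 1 / (real (Suc k) ^ p * real (Suc (k + Suc r)))) sums (v + u)"
        by (intro sums_add u v)
      also have "(\<lambda>k. harm (k + Suc r) / real (Suc k) ^ p + 1 / (real (Suc k) ^ p * real (Suc (k + Suc r))))
        = (\<lambda>k. harm (k + Suc (Suc r)) / real (Suc k) ^ p)"
        by (rule ext) (simp add: harm_Suc add_divide_distrib inverse_eq_divide mult.commute del: of_nat_Suc power_Suc)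
      finally show ?case using u v zeta_reducible_add by blast
    qed
    then show ?thesis using Suc by simp
  qed
qed

section \<open>The values with \<open>p = q = 1\<close>\<close>

lemma tornheim_row_sums:
  assumes "\<And>k. (\<lambda>l. 1 / (real (Suc l) * real (Suc (l + (k + s))))) sums h k"
  shows "(\<lambda>k. h k / real (Suc k)) sums tornheim s 1 1 1"
proof -
  have "(tornheim_term s 1 1 1 has_sum tornheim s 1 1 1) (UNIV \<times> UNIV)"
    by (simp add: tornheim_has_sum)
  moreover have "((\<lambda>l. tornheim_term s 1 1 1 (k, l)) has_sum (h k / real (Suc k))) UNIV" for k
  proof -
    have "((\<lambda>l. 1 / (real (Suc l) * real (Suc (l + (k + s))))) has_sum h k) UNIV"
      using assms by (intro sums_nonneg_imp_has_sum) auto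
    from has_sum_cmult_left[OF this, of "1 / real (Suc k)"] show ?thesis
      by (simp add: tornheim_term_def mult_ac add_ac)
  qed
  ultimately have "((\<lambda>k. h k / real (Suc k)) has_sum tornheim s 1 1 1) UNIV"
    by (rule has_sum_SigmaD)
  then show ?thesis by (rule has_sum_imp_sums)
qed

lemma harm_quotient_sums:
  "(\<lambda>l. 1 / (real (Suc l) * real (Suc (l + Suc n)))) sums (harm (Suc n) / real (Suc n))"
proof -
  have "(\<lambda>l. (1 / real (Suc l) - 1 / real (Suc (l + Suc n))) * (1 / real (Suc n))) sums (harm (Suc n) * (1 / real (Suc n)))"
    by (intro sums_mult2 sums_inverse_diff_shift)
  also have "(\<lambda>l. (1 / real (Suc l) - 1 / real (Suc (l + Suc n))) * (1 / real (Suc n)))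
    = (\<lambda>l. 1 / (real (Suc l) * real (Suc (l + Suc n))))"
    by (rule ext) (simp add: field_simps)
  finally show ?thesis by simp
qed

lemma zeta_reducible_tornheim_0_11: "zeta_reducible (tornheim 0 1 1 1)"
proof -
  \<comment> \<open>Row 0 needs its own value: both factors coincide there and the sum is
    \<open>zeta 2\<close>, while the quotient formula would divide by 0.\<close>
  define h where "h k = (case k of 0 \<Rightarrow> zeta 2 | Suc n \<Rightarrow> harm (Suc n) / real (Suc n))" for k
  have "(\<lambda>l. 1 / (real (Suc l) * real (Suc (l + (k + 0))))) sums h k" for k
    using harm_quotient_sums zeta_sums[of 2] by (cases k) (auto simp: h_def power2_eq_square)
  then have "(\<lambda>k. h k / real (Suc k)) sums tornheim 0 1 1 1" by (rule tornheim_row_sums)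
  then have "(\<lambda>k. h (Suc k) / real (Suc (Suc k))) sums (tornheim 0 1 1 1 - zeta 2)"
    by (subst sums_Suc_iff) (simp add: h_def)
  moreover have "(\<lambda>k. h (Suc k) / real (Suc (Suc k))) sums (1 + (zeta 2 - 1))"
  proof -
    \<comment> \<open>With \<open>n = k + 1\<close> and harmonic numbers \<open>H\<close>, the
      identity used is \<open>H_n / (n (n+1)) = H_n / n - H_(n+1) / (n+1) + 1 / (n+1)^2\<close>: a
      telescoping part plus a tail of \<open>zeta 2\<close>.\<close>
    have "(\<lambda>k. harm (Suc k) / real (Suc k) - harm (Suc (k + 1)) / real (Suc (k + 1)) :: real) sums 1"
      using sums_diff_shift[OF harm_over_tendsto_0, of 1] by (simp add: harm_expand)
    moreover have "(\<lambda>k. 1 / real (Suc (Suc k)) ^ 2) sums (zeta 2 - 1)"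
      using zeta_sums[of 2] by (subst sums_Suc_iff) simp
    ultimately have "(\<lambda>k. harm (Suc k) / real (Suc k) - harm (Suc (k + 1)) / real (Suc (k + 1))
        + 1 / real (Suc (Suc k)) ^ 2) sums (1 + (zeta 2 - 1))"
      by (rule sums_add)
    also have "(\<lambda>k. harm (Suc k) / real (Suc k) - harm (Suc (k + 1)) / real (Suc (k + 1))
        + 1 / real (Suc (Suc k)) ^ 2) = (\<lambda>k. h (Suc k) / real (Suc (Suc k)))"
    proof
      fix k
      define x a where xa: "x = real (Suc k)" "a = (harm (Suc k) :: real)"
      have x: "x > 0" "real (Suc (Suc k)) = x + 1" by (auto simp: xa)
      have b: "harm (Suc (Suc k)) = a + 1 / (x + 1)"
        by (simp add: harm_Suc[of "Suc k"] xa inverse_eq_divide)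
      have "a / x - (a + 1 / (x + 1)) / (x + 1) + 1 / (x + 1)\<^sup>2 = a / x / (x + 1)"
        using x by (simp add: divide_simps) (simp add: power2_eq_square algebra_simps)
      then show "harm (Suc k) / real (Suc k) - harm (Suc (k + 1)) / real (Suc (k + 1))
        + 1 / real (Suc (Suc k)) ^ 2 = h (Suc k) / real (Suc (Suc k))"
        unfolding h_def Suc_eq_plus1[symmetric] nat.case b x(2) xa[symmetric] .
    qed
    finally show ?thesis .
  qed
  ultimately have "tornheim 0 1 1 1 - zeta 2 = 1 + (zeta 2 - 1)" by (rule sums_unique2)
  then have "tornheim 0 1 1 1 = zeta 2 + zeta 2" by simp
  then show ?thesis using zeta_reducible_add[OF zeta_reducible_zeta zeta_reducible_zeta, of 2 2] by simp
qed

text \<open>The value is rational. After multiplication by \<open>r + 1\<close>, the difference of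
  the two linear factors, the series of row sums is a telescoping series plus finitely many series
  from \<open>harm_quotient_sums\<close>.\<close>

lemma zeta_reducible_tornheim_11:
  "zeta_reducible (tornheim (r + 2) 1 1 1)"
proof -
  define g where "g k = (harm (Suc k) / real (Suc k) :: real)" for k
  have "(\<lambda>k. g (k + Suc r) / real (Suc k)) sums tornheim (r + 2) 1 1 1"
  proof (rule tornheim_row_sums)
    fix k
    show "(\<lambda>l. 1 / (real (Suc l) * real (Suc (l + (k + (r + 2)))))) sums g (k + Suc r)"
      using harm_quotient_sums[of "k + Suc r"] by (simp add: g_def)
  qed
  then have "(\<lambda>k. real (Suc r) * (g (k + Suc r) / real (Suc k))) sums (real (Suc r) * tornheim (r + 2) 1 1 1)"
    by (rule sums_mult)
  moreover have "(\<lambda>k. real (Suc r) * (g (k + Suc r) / real (Suc k))) sums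
    ((\<Sum>i<Suc r. g i) + (\<Sum>i<Suc r. harm (Suc i) / real (Suc i)))"
  proof -
    have "(\<lambda>k. g k - g (k + Suc r) + (\<Sum>i<Suc r. 1 / (real (Suc k) * real (Suc (k + Suc i))))) sums
    ((\<Sum>i<Suc r. g i) + (\<Sum>i<Suc r. harm (Suc i) / real (Suc i)))"
      unfolding g_def
      by (intro sums_add sums_sum sums_diff_shift[OF harm_over_tendsto_0] harm_quotient_sums)
    also have "(\<lambda>k. g k - g (k + Suc r) + (\<Sum>i<Suc r. 1 / (real (Suc k) * real (Suc (k + Suc i)))))
      = (\<lambda>k. real (Suc r) * (g (k + Suc r) / real (Suc k)))"
    proof
      fix k
      \<comment> \<open>Here \<open>y - x = r + 1\<close>, so the right side is
        \<open>G / x - G / y\<close>; writing \<open>G = H + (G - H)\<close> isolates the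
        telescoping part, and \<open>G - H\<close> is a sum of \<open>r + 1\<close>
        reciprocals.\<close>
      define x H G y where xH: "x = real (Suc k)" "H = (harm (Suc k) :: real)"
        "G = (harm (Suc (k + Suc r)) :: real)" "y = real (Suc (k + Suc r))"
      have x: "x > 0" "y > 0" "real (Suc r) = y - x" by (auto simp: xH)
      have "G = H + (\<Sum>i<Suc r. 1 / real (Suc (k + Suc i)))"
        using harm_add[of "Suc k" "Suc r"] by (simp add: xH)
      then have "(\<Sum>i<Suc r. 1 / (x * real (Suc (k + Suc i)))) = (G - H) / x"
        by (simp add: sum_divide_distrib mult_ac del: sum.lessThan_Suc)
      moreover have "H / x - G / y + (G - H) / x = (y - x) * (G / y / x)"
        using x by (simp add: field_simps)
      ultimately have "H / x - G / y + (\<Sum>i<Suc r. 1 / (x * real (Suc (k + Suc i)))) = (y - x) * (G / y / x)"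
        by simp
      then show "g k - g (k + Suc r) + (\<Sum>i<Suc r. 1 / (real (Suc k) * real (Suc (k + Suc i))))
        = real (Suc r) * (g (k + Suc r) / real (Suc k))"
        unfolding g_def x(3) unfolding xH .
    qed
    finally show ?thesis .
  qed
  ultimately have "real (Suc r) * tornheim (r + 2) 1 1 1 =
    (\<Sum>i<Suc r. g i) + (\<Sum>i<Suc r. harm (Suc i) / real (Suc i))"
    by (rule sums_unique2)
  moreover have "zeta_reducible ((\<Sum>i<Suc r. g i) + (\<Sum>i<Suc r. harm (Suc i) / real (Suc i)))"
    unfolding g_def by (intro zeta_reducible_Rats Rats_add Rats_sum Rats_divide harm_Rats) auto
  ultimately have "zeta_reducible (real (Suc r) * tornheim (r + 2) 1 1 1)" by simp
  then show ?thesis by (rule zeta_reducible_cancel) (auto simp del: of_nat_Suc)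
qed

section \<open>Induction on the exponents\<close>

lemma zeta_reducible_tornheim_column:
  assumes "p \<ge> 1"
  shows "zeta_reducible (tornheim s p 1 1)"
proof (cases "s = 1")
  case True
  then show ?thesis using zeta_reducible_tornheim_1 assms by simp
next
  case False
  show ?thesis using assms
  proof (induction p rule: dec_induct)
    case base
    have "s = 0 \<or> s = (s - 2) + 2" using False by auto
    then show ?case using zeta_reducible_tornheim_0_11 zeta_reducible_tornheim_11 by metis
  next
    case (step p)
    \<comment> \<open>The harmonic sum is already reducible and combines the known value at
      \<open>p\<close> with the new one at \<open>Suc p\<close>, whose coefficient
      \<open>real s - 1\<close> is nonzero.\<close>
    obtain v where "(\<lambda>k. harm (k + s) / real (Suc k) ^ Suc p) sums v" "zeta_reducible v"
      using harm_sums_reducible[of "Suc p" s] step.hyps by auto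
    with harm_sums_tornheim[of p s] step.hyps
    have "zeta_reducible ((real s - 1) * tornheim s (Suc p) 1 1 + tornheim s p 1 1)"
      using sums_unique2 by metis
    from zeta_reducible_diff[OF this step.IH]
    have "zeta_reducible ((real s - 1) * tornheim s (Suc p) 1 1)" by simp
    then show ?case by (rule zeta_reducible_cancel) (use False in auto)
  qed
qed

lemma zeta_reducible_tornheim:
  assumes "p \<ge> 1" "q \<ge> 1"
  shows "zeta_reducible (tornheim s p q 1)"
  using assms(2,1)
proof (induction q arbitrary: p rule: dec_induct)
  case base
  then show ?case by (rule zeta_reducible_tornheim_column)
next
  case (step q)
  \<comment> \<open>The outer hypothesis, available for every first exponent, disposes of the term
    of \<open>tornheim_step\<close> in which \<open>q\<close> has been lowered.\<close>
  have rec: "zeta_reducible ((real s - 1) * tornheim s (Suc n) (Suc q) 1 + tornheim s n (Suc q) 1)"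
    if "n \<ge> 1" for n
  proof -
    have "zeta_reducible (zeta (Suc n) * zeta (Suc q) - tornheim s (Suc n) q 1)"
      using that step.hyps
      by (intro zeta_reducible_diff zeta_reducible_mult zeta_reducible_zeta step.IH) auto
    also have "zeta (Suc n) * zeta (Suc q) - tornheim s (Suc n) q 1 =
        (real s - 1) * tornheim s (Suc n) (Suc q) 1 + tornheim s n (Suc q) 1"
      using tornheim_step[OF that step.hyps(1), of s] by linarith
    finally show ?thesis .
  qed
  show ?case
  proof (cases "s = 1")
    case True
    \<comment> \<open>The leading coefficient is 0, so the relation is itself the claim and no
      induction on \<open>p\<close> is required.\<close>
    then show ?thesis using rec[OF step.prems] by simp
  next
    case False
    show ?thesis using step.prems
    proof (induction p rule: dec_induct)
      case base
      then show ?case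
        using zeta_reducible_tornheim_column[of "Suc q" s] tornheim_commute by simp
    next
      case (step n)
      have "zeta_reducible ((real s - 1) * tornheim s (Suc n) (Suc q) 1)"
        using zeta_reducible_diff[OF rec[OF step.hyps(1)] step.IH] by simp
      then show ?case by (rule zeta_reducible_cancel) (use False in auto)
    qed
  qed
qed

section \<open>The integral as a Tornheim series\<close>

lemma polylog_sums:
  fixes x :: real
  assumes "p \<ge> 1" "0 < x" "x < 1"
  shows "(\<lambda>k. x ^ Suc k / real (Suc k) ^ p) sums polylog (int p) x"
proof -
  have "summable (\<lambda>k. x ^ Suc k / real (Suc k) ^ p)"
  proof (rule summable_comparison_test'[of "\<lambda>k. x ^ Suc k" 0])
    show "summable (\<lambda>k. x ^ Suc k)"
      using assms by (subst summable_Suc_iff) (auto intro: summable_geometric)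
    fix k :: nat
    have "1 \<le> real (Suc k) ^ p" by (rule one_le_power) auto
    then show "norm (x ^ Suc k / real (Suc k) ^ p) \<le> x ^ Suc k"
      using assms by (simp add: divide_le_eq mult_le_cancel_left1 del: power_Suc of_nat_Suc)
  qed
  then show ?thesis by (simp add: polylog_def power_int_def summable_sums)
qed

text \<open>Expansion in \<open>ennreal\<close> prepares termwise integration of nonnegative terms.
  The factor \<open>x powi (int s - 2)\<close> may have a negative exponent, but
  \<open>x^(k+1) x^(l+1)\<close> contributes at least 2, leaving the natural exponent
  \<open>k + l + s\<close>.\<close>

lemma J_integrand_suminf:
  assumes "p \<ge> 1" "q \<ge> 1" "0 < x" "x < 1"
  shows "ennreal (J_integrand (int s - 2) (int p) (int q) x) =
    (\<Sum>k. \<Sum>l. ennreal (x ^ (k + l + s) / (real (Suc k) ^ p * real (Suc l) ^ q)))"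
proof -
  let ?f = "\<lambda>k l. x ^ (k + l + s) / (real (Suc k) ^ p * real (Suc l) ^ q)"
  define c where "c = x powi (int s - 2)"
  have f: "c * (x ^ Suc k / real (Suc k) ^ p) * (x ^ Suc l / real (Suc l) ^ q) = ?f k l" for k l
  proof -
    have "x powi (int s - 2) * x ^ Suc k * x ^ Suc l
        = x powi (int s - 2) * x powi int (Suc k) * x powi int (Suc l)"
      by (simp only: power_int_of_nat)
    also have "\<dots> = x powi (int s - 2 + int (Suc k) + int (Suc l))"
      using assms by (simp add: power_int_add[symmetric])
    also have "int s - 2 + int (Suc k) + int (Suc l) = int (k + l + s)" by simp
    finally have "c * x ^ Suc k * x ^ Suc l = x ^ (k + l + s)"
      by (simp only: c_def power_int_of_nat)
    then show ?thesis by (simp add: mult_ac del: power_Suc of_nat_Suc)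
  qed
  have row: "?f k sums (c * (x ^ Suc k / real (Suc k) ^ p) * polylog (int q) x)" for k
    unfolding f[symmetric] using assms by (intro sums_mult polylog_sums)
  have nonneg: "?f k l \<ge> 0" for k l using assms by auto
  have row_nonneg: "c * (x ^ Suc k / real (Suc k) ^ p) * polylog (int q) x \<ge> 0" for k
    using row nonneg by (rule sums_le[OF _ sums_zero, rotated])
  have "(\<lambda>k. c * (x ^ Suc k / real (Suc k) ^ p) * polylog (int q) x) sums
      (c * polylog (int p) x * polylog (int q) x)"
    using assms by (intro sums_mult2 sums_mult polylog_sums)
  moreover have "(\<Sum>l. ennreal (?f k l)) = ennreal (c * (x ^ Suc k / real (Suc k) ^ p) * polylog (int q) x)" for k
    using row by (intro suminf_ennreal_eq nonneg)
  ultimately show ?thesis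
    by (simp only: J_integrand_def c_def[symmetric] suminf_ennreal_eq[OF row_nonneg])
qed

lemma nn_integral_power_0_1:
  fixes c :: real
  assumes "c \<ge> 0"
  shows "(\<integral>\<^sup>+ x. ennreal (c * x ^ n) * indicator {0<..<1} x \<partial>lborel) = ennreal (c / real (Suc n))"
proof -
  have "(\<integral>\<^sup>+ x. ennreal (c * x ^ n) * indicator {0<..<1} x \<partial>lborel)
      = (\<integral>\<^sup>+ x. ennreal (c * x ^ n) * indicator {0..1} x \<partial>lborel)"
  \<comment> \<open>The endpoints form a null set; the fundamental theorem is applied on the closed
    interval.\<close>
  proof (rule nn_integral_cong_AE)
    have "AE x in lborel. x \<noteq> (0 :: real)" "AE x in lborel. x \<noteq> (1 :: real)"
      by (auto intro: AE_lborel_singleton)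
    then show "AE x in lborel. ennreal (c * x ^ n) * indicator {0<..<1} x = ennreal (c * x ^ n) * indicator {0..1} x"
      by eventually_elim (auto simp: indicator_def)
  qed
  also have "\<dots> = ennreal (c * 1 ^ Suc n / real (Suc n) - c * 0 ^ Suc n / real (Suc n))"
  proof (rule nn_integral_FTC_Icc)
    fix x :: real
    show "((\<lambda>x. c * x ^ Suc n / real (Suc n)) has_real_derivative c * x ^ n) (at x)"
      using DERIV_cmult[OF DERIV_pow[of "Suc n" x UNIV], of "c / real (Suc n)"]
      by (simp add: mult_ac del: of_nat_Suc power_Suc)
  qed (use assms in auto)
  finally show ?thesis by simp
qed

text \<open>Turns the unordered double sum into the iterated \<open>ennreal\<close> sum that
  termwise integration produces.\<close>

lemma tornheim_eq_suminf:
  assumes "p \<ge> 1" "q \<ge> 1"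
  shows "(\<Sum>k. \<Sum>l. ennreal (tornheim_term s p q 1 (k, l))) = ennreal (tornheim s p q 1)"
proof -
  have total: "(tornheim_term s p q 1 has_sum tornheim s p q 1) (UNIV \<times> UNIV)"
    using assms by (simp add: tornheim_has_sum)
  define g where "g k = (\<Sum>\<^sub>\<infinity>l. tornheim_term s p q 1 (k, l))" for k
  have "(\<lambda>(k, l). tornheim_term s p q 1 (k, l)) summable_on (UNIV \<times> UNIV)"
    unfolding case_prod_eta using total by (rule has_sum_imp_summable)
  then have g: "((\<lambda>l. tornheim_term s p q 1 (k, l)) has_sum g k) UNIV" for k
    unfolding g_def by (intro has_sum_infsum summable_on_SigmaD1[where B = "\<lambda>_. UNIV" and A = UNIV]) auto
  have "(\<Sum>l. ennreal (tornheim_term s p q 1 (k, l))) = ennreal (g k)" for k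
    using has_sum_imp_sums[OF g] by (intro suminf_ennreal_eq tornheim_term_nonneg)
  moreover have "g k \<ge> 0" for k
    unfolding g_def by (intro infsum_nonneg tornheim_term_nonneg)
  then have "(\<Sum>k. ennreal (g k)) = ennreal (tornheim s p q 1)"
    using has_sum_imp_sums[OF has_sum_SigmaD[OF total g]] by (intro suminf_ennreal_eq)
  ultimately show ?thesis by simp
qed

lemma polylog_nonneg:
  fixes x :: real
  assumes "p \<ge> 1" "0 < x" "x < 1"
  shows "polylog (int p) x \<ge> 0"
proof -
  have "x ^ Suc k / real (Suc k) ^ p \<ge> 0" for k using assms(2) by simp
  from sums_le[OF this sums_zero polylog_sums[OF assms]] show ?thesis .
qed

text \<open>All terms are nonnegative, so both sums may be exchanged with the integral; integrating
  \<open>x^(k+l+s)\<close> creates the factor \<open>1 / (k + l + s + 1)\<close>. Convergence of the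
  Tornheim series makes the integral finite.\<close>

lemma J_has_integral:
  assumes "p \<ge> 1" "q \<ge> 1"
  shows "(J_integrand (int s - 2) (int p) (int q) has_integral tornheim s p q 1) {0<..<1}"
proof -
  let ?J = "J_integrand (int s - 2) (int p) (int q)"
  define f where "f k l x = ennreal (x ^ (k + l + s) / (real (Suc k) ^ p * real (Suc l) ^ q)) * indicator {0<..<1} x"
    for k l x
  define F where "F x = (if x \<in> {0<..<1} then ?J x else 0)" for x
  have F_eq: "ennreal (F x) = (\<Sum>k. \<Sum>l. f k l x)" for x
  proof (cases "x \<in> {0<..<1}")
    case True
    then have x: "0 < x" "x < 1" and ind: "indicator {0<..<1} x = (1 :: ennreal)" by auto
    have "F x = ?J x" using True unfolding F_def by (rule if_P)
    then show ?thesis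
      unfolding f_def ind by (simp only: J_integrand_suminf[OF assms x] mult_1_right)
  qed (auto simp: F_def f_def)
  have F_nonneg: "F x \<ge> 0" for x
    using assms by (auto simp: F_def J_integrand_def polylog_nonneg)
  have f_meas [measurable]: "f k l \<in> borel_measurable borel" for k l
    unfolding f_def by measurable
  \<comment> \<open>Measurability of the integrand, extended by 0 to the whole line, is read off
    from its series.\<close>
  have "(\<lambda>x. enn2real (\<Sum>k. \<Sum>l. f k l x)) \<in> borel_measurable borel"
    by measurable
  then have F_meas: "F \<in> borel_measurable borel"
    unfolding F_eq[symmetric] using F_nonneg by simp
  have f_int: "(\<integral>\<^sup>+ x. f k l x \<partial>lborel) = ennreal (tornheim_term s p q 1 (k, l))" for k l
  proof -
    have "f k l x = ennreal (1 / (real (Suc k) ^ p * real (Suc l) ^ q) * x ^ (k + l + s)) * indicator {0<..<1} x" for x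
      unfolding f_def by simp
    then show ?thesis
      using nn_integral_power_0_1[of "1 / (real (Suc k) ^ p * real (Suc l) ^ q)" "k + l + s"]
      unfolding tornheim_term_def by (simp del: of_nat_Suc)
  qed
  have "(\<integral>\<^sup>+ x. ennreal (F x) \<partial>lborel) = (\<Sum>k. \<integral>\<^sup>+ x. (\<Sum>l. f k l x) \<partial>lborel)"
    unfolding F_eq by (rule nn_integral_suminf) measurable
  also have "\<dots> = (\<Sum>k. \<Sum>l. \<integral>\<^sup>+ x. f k l x \<partial>lborel)"
    by (subst nn_integral_suminf) simp_all
  also have "\<dots> = ennreal (tornheim s p q 1)"
    unfolding f_int by (rule tornheim_eq_suminf[OF assms])
  finally have "(F has_integral tornheim s p q 1) UNIV"
    by (intro nn_integral_has_integral F_meas F_nonneg)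
       (auto simp: tornheim_def intro!: infsum_nonneg tornheim_term_nonneg)
  then show ?thesis
    unfolding F_def by (subst (asm) has_integral_restrict_UNIV)
qed

theorem theorem1:
  fixes m p q :: int
  assumes "p \<ge> 1" and "q \<ge> 1" and "m \<ge> -2"
  shows "J_integrand m p q integrable_on {0<..<1} \<and> zeta_reducible (J m p q)"
proof -
  \<comment> \<open>The bound \<open>m \<ge> -2\<close> makes \<open>m + 2\<close> a natural number,
    so \<open>nat\<close> truncates nothing.\<close>
  define s where "s = nat (m + 2)"
  have m: "m = int s - 2" "p = int (nat p)" "q = int (nat q)" using assms by (auto simp: s_def)
  have pq: "nat p \<ge> 1" "nat q \<ge> 1" using assms by auto
  have "(J_integrand m p q has_integral tornheim s (nat p) (nat q) 1) {0<..<1}"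
    using J_has_integral[OF pq, of s] m by simp
  then show ?thesis
    using zeta_reducible_tornheim[OF pq, of s] unfolding J_def by (auto simp: integral_unique)
qed

end
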